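(* Let $0<\sigma<\infty$. Every weak$^*$ exposed point of $D(B^1_\sigma)$ is weak$^*$ strongly exposed; that is, the set of weak$^*$ exposed points of $D(B^1_\sigma)$ equals the set of weak$^*$ strongly exposed points of $D(B^1_\sigma)$.
   Context: For $0<\sigma<\infty$, $B^1_\sigma$ is the space of $f\in L^1(\mathbb{R})$ whose Fourier transform is supported in $[-\sigma,\sigma]$, with the $L^1(\mathbb{R})$ norm; $D(B^1_\sigma)$ is its closed unit ball. $C_0(\mathbb{R})$ is the space of continuous complex functions vanishing at infinity; with $\mathfrak{I}_\sigma$ the finite complex Borel measures on $\mathbb{R}$ whose Fourier–Stieltjes transform vanishes for $|t|\ge\sigma$ and $C_{0,\sigma}(\mathbb{R})=\{u\in C_0(\mathbb{R}):\int u\,d\mu=0\ \forall\mu\in\mathfrak{I}_\sigma\}$, $B^1_\sigma$ is the dual of $C_0(\mathbb{R})/C_{0,\sigma}(\mathbb{R})$ via $\langle f,[u]\rangle=\int f u\,dx$; weak$^*$ refers to this duality. A point $f\in D(B^1_\sigma)$ is exposed if there is a continuous linear functional $\Phi_f$ on $B^1_\sigma$ with $\Phi_f(f)=\|\Phi_f\|=1$ and $\mathrm{Re}\,\Phi_f(g)<1$ for all $g\in D(B^1_\sigma)$, $g\ne f$ (this functional is unique). An exposed $f$ is strongly exposed if every sequence $(f_n)$ in $D(B^1_\sigma)$ with $\Phi_f(f_n)\to1$ converges to $f$ in norm; it is weak$^*$ exposed if $\Phi_f$ is weak$^*$ continuous; it is weak$^*$ strongly exposed if it is both weak$^*$ exposed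 and strongly exposed. *)

theory Defs
  imports "HOL-Analysis.Analysis"
begin

type_synonym cfun = "real \<Rightarrow> complex"

text \<open>Fourier transform of an integrable function (sign convention irrelevant here,
  since the support condition is symmetric).\<close>
definition fourier :: "cfun \<Rightarrow> real \<Rightarrow> complex" where
  "fourier f t = (LINT x|lborel. f x * cis (- (t * x)))"

definition l1norm :: "cfun \<Rightarrow> real" where
  "l1norm f = (LINT x|lborel. cmod (f x))"

text \<open>The space B^1_sigma (functions; elements of L^1 are identified up to
  a.e. equality, i.e. up to l1norm-distance zero).\<close>
definition Bsig :: "real \<Rightarrow> cfun set" where
  "Bsig \<sigma> = {f. integrable lborel f \<and>
               closure {t. fourier f t \<noteq> 0} \<subseteq> {-\<sigma>..\<sigma>}}"

definition Dsig :: "real \<Rightarrow> cfun set" where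
  "Dsig \<sigma> = {f \<in> Bsig \<sigma>. l1norm f \<le> 1}"

definition C0 :: "cfun set" where
  "C0 = {u. continuous_on UNIV u \<and> (u \<longlongrightarrow> 0) at_infinity}"

definition cont_lin_functional :: "real \<Rightarrow> (cfun \<Rightarrow> complex) \<Rightarrow> bool" where
  "cont_lin_functional \<sigma> \<Phi> \<longleftrightarrow>
     (\<forall>f\<in>Bsig \<sigma>. \<forall>g\<in>Bsig \<sigma>. \<forall>a b::complex.
        \<Phi> (\<lambda>x. a * f x + b * g x) = a * \<Phi> f + b * \<Phi> g) \<and>
     (\<exists>C. \<forall>f\<in>Bsig \<sigma>. cmod (\<Phi> f) \<le> C * l1norm f)"

definition fnorm :: "real \<Rightarrow> (cfun \<Rightarrow> complex) \<Rightarrow> real" where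
  "fnorm \<sigma> \<Phi> = (SUP g\<in>Dsig \<sigma>. cmod (\<Phi> g))"

definition exposes :: "real \<Rightarrow> (cfun \<Rightarrow> complex) \<Rightarrow> cfun \<Rightarrow> bool" where
  "exposes \<sigma> \<Phi> f \<longleftrightarrow> f \<in> Dsig \<sigma> \<and> cont_lin_functional \<sigma> \<Phi> \<and>
     \<Phi> f = 1 \<and> fnorm \<sigma> \<Phi> = 1 \<and>
     (\<forall>g\<in>Dsig \<sigma>. l1norm (\<lambda>x. g x - f x) \<noteq> 0 \<longrightarrow> Re (\<Phi> g) < 1)"

definition exposed_point :: "real \<Rightarrow> cfun \<Rightarrow> bool" where
  "exposed_point \<sigma> f \<longleftrightarrow> (\<exists>\<Phi>. exposes \<sigma> \<Phi> f)"

definition strongly_exposed_point :: "real \<Rightarrow> cfun \<Rightarrow> bool" where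
  "strongly_exposed_point \<sigma> f \<longleftrightarrow>
     (\<exists>\<Phi>. exposes \<sigma> \<Phi> f \<and>
        (\<forall>fs :: nat \<Rightarrow> cfun. (\<forall>n. fs n \<in> Dsig \<sigma>) \<longrightarrow> (\<lambda>n. \<Phi> (fs n)) \<longlonglongrightarrow> 1 \<longrightarrow>
            (\<lambda>n. l1norm (\<lambda>x. fs n x - f x)) \<longlonglongrightarrow> 0))"

text \<open>The weak* topology on B^1_sigma = (C_0(R)/C_{0,sigma}(R))^*: the coarsest topology
  making all maps g \<mapsto> \<integral> g u, u \<in> C_0(R), continuous.\<close>
definition weakstar_top :: "real \<Rightarrow> cfun topology" where
  "weakstar_top \<sigma> = subtopology
     (topology_generated_by
        {{g \<in> Bsig \<sigma>. (LINT x|lborel. g x * u x) \<in> U} | u U. u \<in> C0 \<and> open U})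
     (Bsig \<sigma>)"

definition weakstar_continuous :: "real \<Rightarrow> (cfun \<Rightarrow> complex) \<Rightarrow> bool" where
  "weakstar_continuous \<sigma> \<Phi> \<longleftrightarrow> continuous_map (weakstar_top \<sigma>) euclidean \<Phi>"

definition weakstar_exposed_point :: "real \<Rightarrow> cfun \<Rightarrow> bool" where
  "weakstar_exposed_point \<sigma> f \<longleftrightarrow> (\<exists>\<Phi>. exposes \<sigma> \<Phi> f \<and> weakstar_continuous \<sigma> \<Phi>)"

definition weakstar_strongly_exposed_point :: "real \<Rightarrow> cfun \<Rightarrow> bool" where
  "weakstar_strongly_exposed_point \<sigma> f \<longleftrightarrow>
     weakstar_exposed_point \<sigma> f \<and> strongly_exposed_point \<sigma> f"

end

theory Submission
  imports Defs "HOL-Probability.Levy" "HOL-Complex_Analysis.Great_Picard"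
begin

text \<open>
  Let the weak* continuous functional \<open>\<Phi>\<close> expose \<open>f\<close>, and let \<open>\<Phi> (f\<^sub>n) \<rightarrow> 1\<close> with all \<open>f\<^sub>n\<close> in the
  unit ball. By Fourier inversion each \<open>f\<^sub>n\<close> agrees almost everywhere with the inversion integral over
  \<open>[-\<sigma>, \<sigma>]\<close>, so these representatives are uniformly bounded and uniformly Lipschitz, and a
  subsequence converges pointwise to some \<open>g\<close>. By Fatou \<open>g\<close> has norm at most 1, the convergence is
  weak*, and testing against the Fourier transforms of indicators of intervals off \<open>[-\<sigma>, \<sigma>]\<close> shows
  that \<open>g\<close> is band-limited. Hence \<open>\<Phi> g = 1\<close>, which forces \<open>g = f\<close>. Since \<open>f\<close> has norm 1, the norms do
  not increase in the limit, and Scheffe's lemma upgrades pointwise convergence to norm convergence.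
\<close>

section \<open>Functions with vanishing integrals over intervals\<close>

text \<open>Half-open intervals are an intersection-stable generator of the Borel sets, and the sets
  over which the truncated function integrates to zero form a Dynkin system. Integrability is
  assumed only on intervals because one application involves a Fourier transform known merely to be
  continuous.\<close>

lemma AE_eq_0_if_Ioc_integrals_eq_0:
  fixes d :: "real \<Rightarrow> 'b::{banach,second_countable_topology}"
  assumes int: "\<And>a b. set_integrable lborel {a<..b} d"
    and zero: "\<And>a b. a \<le> b \<Longrightarrow> (LINT x:{a<..b}|lborel. d x) = 0"
  shows "AE x in lborel. d x = 0"
proof -
  have zero': "(LINT x:{a<..b}|lborel. d x) = 0" for a b
    using zero[of a b] by (cases "a \<le> b") (auto simp: set_lebesgue_integral_def)
  have "AE x in lborel. indicator {- real N<..real N} x *\<^sub>R d x = 0" for N :: nat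
  proof -
    \<comment> \<open>Truncating to a bounded window makes the function globally integrable, as
      complements and countable unions require.\<close>
    define e where "e = (\<lambda>x. indicator {- real N<..real N} x *\<^sub>R d x)"
    have e: "integrable lborel e"
      using int[of "- real N" "real N"] by (simp add: e_def set_integrable_def)
    have eset: "set_integrable lborel A e" if "A \<in> sets lborel" for A
      unfolding set_integrable_def by (rule integrable_mult_indicator[OF that e])
    have tot: "(LINT x|lborel. e x) = 0"
      using zero'[of "- real N" "real N"] by (simp add: e_def set_lebesgue_integral_def)
    define G where "G = range (\<lambda>(a, b). {a <.. b::real})"
    have sets_G: "sets lborel = sigma_sets UNIV G"
      by (simp add: borel_sigma_sets_Ioc G_def)
    have G: "Int_stable G" "G \<subseteq> Pow UNIV"
      by (auto simp: Int_stable_def G_def)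
    have "(LINT x:A|lborel. e x) = 0" if "A \<in> sets lborel" for A
    proof -
      from that have "A \<in> sigma_sets UNIV G" unfolding sets_G .
      with G show ?thesis
      proof (induction rule: sigma_sets_induct_disjoint)
        case (basic A)
        then obtain a b where A: "A = {a<..b}" by (auto simp: G_def)
        \<comment> \<open>The window meets an interval in a half-open interval again, possibly with
          reversed endpoints and hence empty; \<open>zero'\<close> covers both cases.\<close>
        have "(LINT x:A|lborel. e x) = (LINT x:{max a (- real N)<..min b (real N)}|lborel. d x)"
          unfolding set_lebesgue_integral_def e_def A
          by (intro Bochner_Integration.integral_cong) (auto split: split_indicator)
        then show ?case by (simp add: zero')
      next
        case empty
        then show ?case by (simp add: set_lebesgue_integral_def)
      next
        case (compl A)
        then have A: "A \<in> sets lborel" unfolding sets_G by simp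
        have "(LINT x:UNIV - A|lborel. e x) = (LINT x|lborel. e x - indicator A x *\<^sub>R e x)"
          unfolding set_lebesgue_integral_def
          by (intro Bochner_Integration.integral_cong) (auto split: split_indicator)
        also have "\<dots> = 0"
          using compl tot e eset[OF A]
          by (subst Bochner_Integration.integral_diff)
             (auto simp: set_lebesgue_integral_def set_integrable_def)
        finally show ?case .
      next
        case (union A)
        have "range A \<subseteq> sets lborel" using union unfolding sets_G by simp
        then have A: "A i \<in> sets lborel" for i by auto
        have "(LINT x:(\<Union>i. A i)|lborel. e x) = (\<Sum>i. (LINT x:A i|lborel. e x))"
          using union A
          by (intro lebesgue_integral_countable_add eset sets.countable_UN)
             (auto simp: disjoint_family_on_def)
        then show ?case using union by simp
      qed
    qed
    from sigma_finite_measure.density_zero[OF lborel.sigma_finite_measure_axioms e this] show ?thesis by (simp add: e_def)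
  qed
  then have "AE x in lborel. \<forall>N::nat. indicator {- real N<..real N} x *\<^sub>R d x = 0"
    by (subst AE_all_countable) auto
  then show ?thesis
  proof eventually_elim
    case (elim x)
    obtain N :: nat where "\<bar>x\<bar> < real N" using reals_Archimedean2 by blast
    with elim[rule_format, of N] show ?case by (auto simp: indicator_def)
  qed
qed

text \<open>The indefinite integral started slightly left of \<open>t\<close> is identically zero,
  while its derivative at \<open>t\<close> is \<open>h t\<close>.\<close>

lemma continuous_eq_0_if_Ioc_integrals_eq_0:
  fixes h :: "real \<Rightarrow> complex"
  assumes cont: "continuous_on UNIV h" and "e > 0"
    and zero: "\<And>a b. t - e < a \<Longrightarrow> a \<le> b \<Longrightarrow> b < t + e \<Longrightarrow> (LINT x:{a<..b}|lborel. h x) = 0"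
  shows "h t = 0"
proof -
  define a where "a = t - e / 2"
  have c: "continuous_on {a..y} h" for y by (rule continuous_on_subset[OF cont]) simp
  have int0: "integral {a..y} h = 0" if "y \<in> {a..t}" for y
  proof -
    have ay: "a \<le> y" using that by simp
    have "set_integrable lborel {a..y} h"
      unfolding set_integrable_def by (intro borel_integrable_compact c) simp
    from interval_integral_eq_integral[OF ay this] have "integral {a..y} h = (LINT x:{a<..y}|lborel. h x)"
      using ay by (simp add: interval_integral_Ioc)
    then show ?thesis using zero[of a y] that \<open>e > 0\<close> by (simp add: a_def)
  qed
  have at: "a < t" using \<open>e > 0\<close> by (simp add: a_def)
  \<comment> \<open>Here \<open>t\<close> is the right endpoint, so this is a one-sided derivative;
    it still has a unique value.\<close>
  have "((\<lambda>y. integral {a..y} h) has_vector_derivative h t) (at t within {a..t})"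
    by (rule integral_has_vector_derivative[OF c]) (use at in simp)
  then have "((\<lambda>y. 0) has_vector_derivative h t) (at t within {a..t})"
    by (rule has_vector_derivative_transform[rotated -1]) (use at int0 in auto)
  then show ?thesis
    using vector_derivative_unique_within_closed_interval[OF at, of t "\<lambda>y. 0" "h t" 0] at
    by (simp add: has_vector_derivative_const)
qed

section \<open>Fourier transform and inversion\<close>

lemma integrable_mult_cis:
  assumes "integrable lborel (f :: real \<Rightarrow> complex)"
  shows "integrable lborel (\<lambda>x. f x * cis (- (t * x)))"
proof -
  have [measurable]: "cis \<in> borel_measurable borel"
    by (intro borel_measurable_continuous_onI continuous_intros)
  have [measurable]: "f \<in> borel_measurable lborel"
    using assms by (rule borel_measurable_integrable)
  show ?thesis
    by (rule Bochner_Integration.integrable_bound[OF assms]) (simp_all add: norm_mult)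
qed

lemma norm_fourier_le: "cmod (fourier f t) \<le> l1norm f"
  unfolding fourier_def l1norm_def
  using integral_norm_bound[of lborel "\<lambda>x. f x * cis (- (t * x))"] by (simp add: norm_mult)

lemma isCont_fourier:
  assumes f: "integrable lborel f"
  shows "isCont (fourier f) t"
  unfolding continuous_at_sequentially comp_def
proof (intro allI impI)
  fix X :: "nat \<Rightarrow> real" assume X: "X \<longlonglongrightarrow> t"
  show "(\<lambda>n. fourier f (X n)) \<longlonglongrightarrow> fourier f t"
    unfolding fourier_def
  proof (rule integral_dominated_convergence[where w = "\<lambda>x. cmod (f x)"])
    show "AE x in lborel. (\<lambda>n. f x * cis (- (X n * x))) \<longlonglongrightarrow> f x * cis (- (t * x))"
      by (intro AE_I2 tendsto_intros X)
  qed (use f integrable_mult_cis[OF f] in \<open>auto simp: norm_mult\<close>)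
qed

lemma continuous_on_fourier: "integrable lborel f \<Longrightarrow> continuous_on A (fourier f)"
  by (simp add: continuous_at_imp_continuous_on isCont_fourier)

section \<open>Fourier transforms of interval indicators\<close>

definition Ioc_kernel :: "real \<Rightarrow> real \<Rightarrow> real \<Rightarrow> complex" where
  "Ioc_kernel a b = fourier (\<lambda>x. indicator {a<..b} x)"

lemma integrable_Ioc: "integrable lborel (\<lambda>x. indicator {a<..b::real} x :: complex)"
proof -
  have "integrable lborel (\<lambda>x. complex_of_real (indicator {a<..b} x))"
    by (cases "a \<le> b") (auto intro!: integrable_of_real integrable_real_indicator)
  then show ?thesis by (simp add: of_real_indicator)
qed

lemma Ioc_kernel_eq:
  assumes "a \<le> b" "t \<noteq> 0"
  shows "Ioc_kernel a b t = (cis (- (t * a)) - cis (- (t * b))) / (\<i> * t)"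
proof -
  have "Ioc_kernel a b t = (LBINT x:{a<..b}. cis (- (t * x)))"
    unfolding Ioc_kernel_def fourier_def set_lebesgue_integral_def
    by (intro Bochner_Integration.integral_cong) (auto split: split_indicator)
  also have "\<dots> = (LBINT x=ereal a..ereal b. cis (- (t * x)))"
    using assms by (simp add: interval_integral_Ioc)
  also have "\<dots> = \<i> * cis (- (t * b)) / t - \<i> * cis (- (t * a)) / t"
  proof (rule interval_integral_FTC_finite)
    show "continuous_on {min a b..max a b} (\<lambda>x. cis (- (t * x)))"
      by (intro continuous_intros)
    fix x
    show "((\<lambda>x. \<i> * cis (- (t * x)) / t) has_vector_derivative cis (- (t * x)))
            (at x within {min a b..max a b})"
      using assms unfolding cis_conv_exp
      by (auto intro!: derivative_eq_intros simp: has_vector_derivative_complex_iff Re_exp Im_exp)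
  qed
  also have "\<dots> = (cis (- (t * a)) - cis (- (t * b))) / (\<i> * t)"
    using assms by (simp add: field_simps)
  finally show ?thesis .
qed

text \<open>The transform of an integrable function is continuous, and the explicit formula gives
  decay of order \<open>2 / \<bar>t\<bar>\<close>. The kernel is thereby an admissible test function
  for weak* convergence.\<close>

lemma Ioc_kernel_C0:
  assumes "a \<le> b"
  shows "Ioc_kernel a b \<in> C0"
proof -
  have "((\<lambda>t::real. 2 / \<bar>t\<bar>) \<longlongrightarrow> 0) at_infinity"
    by (intro real_tendsto_divide_at_top[OF tendsto_const]) (simp flip: real_norm_def add: filterlim_norm_at_top)
  moreover have "cmod (Ioc_kernel a b t) \<le> 2 / \<bar>t\<bar>" if "1 \<le> norm t" for t
  proof -
    have "t \<noteq> 0" using that by auto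
    then have "cmod (Ioc_kernel a b t) = cmod (cis (- (t * a)) - cis (- (t * b))) / \<bar>t\<bar>"
      by (simp add: Ioc_kernel_eq[OF assms] norm_divide norm_mult)
    also have "\<dots> \<le> 2 / \<bar>t\<bar>"
      using norm_triangle_ineq4[of "cis (- (t * a))" "cis (- (t * b))"] by (intro divide_right_mono) auto
    finally show ?thesis .
  qed
  then have "\<forall>\<^sub>F t in at_infinity. cmod (Ioc_kernel a b t) \<le> 2 / \<bar>t\<bar>"
    unfolding eventually_at_infinity by blast
  ultimately have "(Ioc_kernel a b \<longlongrightarrow> 0) at_infinity"
    by (rule Lim_null_comparison[rotated])
  then show ?thesis
    unfolding C0_def Ioc_kernel_def using continuous_on_fourier[OF integrable_Ioc] by simp
qed

text \<open>Fubini moves the transform from \<open>w\<close> onto the indicator. This evaluates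
  inversion integrals, and it also turns averages of a transform into pairings with a
  \<open>C0\<close> function.\<close>

lemma Ioc_integral_fourier:
  assumes w: "integrable lborel w"
  shows "(LINT x:{a<..b}|lborel. fourier w x) = (LINT t|lborel. w t * Ioc_kernel a b t)"
proof -
  have [measurable]: "cis \<in> borel_measurable borel"
    by (intro borel_measurable_continuous_onI continuous_intros)
  have [measurable]: "w \<in> borel_measurable lborel"
    using w by (rule borel_measurable_integrable)
  \<comment> \<open>An integrable product majorant: the factor \<open>cis\<close> omitted here has
    modulus 1.\<close>
  have *: "integrable (lborel \<Otimes>\<^sub>M lborel) (\<lambda>(t, x). w t * indicator {a<..b} x)"
    by (rule lborel_pair.Fubini_integrable) (use w integrable_Ioc in \<open>auto simp: norm_mult\<close>)
  have "integrable (lborel \<Otimes>\<^sub>M lborel) (\<lambda>(t, x). w t * (indicator {a<..b} x * cis (- (x * t))))"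
    by (rule Bochner_Integration.integrable_bound[OF *]) (auto simp: norm_mult split_beta')
  from lborel_pair.Fubini_integral[OF this]
  have "(LINT x|lborel. LINT t|lborel. w t * (indicator {a<..b} x * cis (- (x * t)))) =
        (LINT t|lborel. LINT x|lborel. w t * (indicator {a<..b} x * cis (- (x * t))))" .
  also have "\<dots> = (LINT t|lborel. w t * Ioc_kernel a b t)"
    by (simp add: Ioc_kernel_def fourier_def mult.commute[of _ "_ :: real"])
  also have "(LINT x|lborel. LINT t|lborel. w t * (indicator {a<..b} x * cis (- (x * t)))) =
             (LINT x:{a<..b}|lborel. fourier w x)"
    unfolding set_lebesgue_integral_def fourier_def
    by (intro Bochner_Integration.integral_cong) (auto split: split_indicator)
  finally show ?thesis .
qed

section \<open>Levy inversion for integrable functions\<close>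

lemma continuous_on_fourier_uminus:
  assumes "integrable lborel f"
  shows "continuous_on A (\<lambda>t. fourier f (- t))"
  by (rule continuous_on_compose2[OF continuous_on_fourier[OF assms, of UNIV], of A uminus])
     (auto intro!: continuous_intros)

lemma integrable_kernel_fourier:
  assumes "integrable lborel f"
  shows "integrable lborel (\<lambda>t. indicator {- real n<..<real n} t *\<^sub>R (Ioc_kernel a b t * fourier f (- t)))"
proof -
  have "continuous_on {- real n..real n} (\<lambda>t. Ioc_kernel a b t * fourier f (- t))"
    unfolding Ioc_kernel_def
    by (intro continuous_on_mult continuous_on_fourier continuous_on_fourier_uminus integrable_Ioc assms)
  then have "set_integrable lborel {- real n..real n} (\<lambda>t. Ioc_kernel a b t * fourier f (- t))"
    unfolding set_integrable_def by (intro borel_integrable_compact) simp_all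
  then show ?thesis
    unfolding set_integrable_def[symmetric] by (rule set_integrable_subset) auto
qed

text \<open>
  The kernel of Levy's inversion formula at a nonzero \<open>t\<close> is \<open>Ioc_kernel a b t\<close>; the reflection
  \<open>- t\<close> converts the sign convention of characteristic functions into that of \<^const>\<open>fourier\<close>.
\<close>

definition truncated_inversion :: "real \<Rightarrow> real \<Rightarrow> (real \<Rightarrow> complex) \<Rightarrow> nat \<Rightarrow> complex" where
  "truncated_inversion a b f n = 1 / (2 * pi) *
     (LINT t|lborel. indicator {- real n<..<real n} t *\<^sub>R (Ioc_kernel a b t * fourier f (- t)))"

lemma fourier_lincomb:
  assumes "integrable lborel f" "integrable lborel g"
  shows "fourier (\<lambda>x. c * f x + d * g x) t = c * fourier f t + d * fourier g t"
  unfolding fourier_def using integrable_mult_cis[OF assms(1), of t] integrable_mult_cis[OF assms(2), of t]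
  by (simp add: distrib_right mult.assoc)

lemma truncated_inversion_lincomb:
  assumes "integrable lborel f" "integrable lborel g"
  shows "truncated_inversion a b (\<lambda>x. c * f x + d * g x) n
          = c * truncated_inversion a b f n + d * truncated_inversion a b g n"
proof -
  have "(LINT t|lborel. indicator {- real n<..<real n} t *\<^sub>R
            (Ioc_kernel a b t * fourier (\<lambda>x. c * f x + d * g x) (- t)))
      = (LINT t|lborel. c * (indicator {- real n<..<real n} t *\<^sub>R (Ioc_kernel a b t * fourier f (- t)))
          + d * (indicator {- real n<..<real n} t *\<^sub>R (Ioc_kernel a b t * fourier g (- t))))"
    by (intro Bochner_Integration.integral_cong refl)
       (simp add: fourier_lincomb assms algebra_simps scaleR_conv_of_real)
  also have "\<dots> = c * (LINT t|lborel. indicator {- real n<..<real n} t *\<^sub>R (Ioc_kernel a b t * fourier f (- t)))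
      + d * (LINT t|lborel. indicator {- real n<..<real n} t *\<^sub>R (Ioc_kernel a b t * fourier g (- t)))"
    using integrable_kernel_fourier[OF assms(1)] integrable_kernel_fourier[OF assms(2)]
    by (subst Bochner_Integration.integral_add) (auto simp del: mult_scaleR_right)
  finally show ?thesis
    by (simp add: truncated_inversion_def algebra_simps add_divide_distrib)
qed

text \<open>Such an \<open>h\<close> is the density of a probability measure, so Levy's inversion
  theorem for characteristic functions applies. General integrable functions are reached from this
  case by linearity.\<close>

lemma inversion_density:
  fixes h :: "real \<Rightarrow> real"
  assumes ab: "a \<le> b" and h: "integrable lborel h" and pos: "\<And>x. 0 \<le> h x"
    and one: "(LINT x|lborel. h x) = 1"
  shows "truncated_inversion a b (\<lambda>x. of_real (h x)) \<longlonglongrightarrow> (LINT x:{a<..b}|lborel. of_real (h x))"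
proof -
  have [measurable]: "h \<in> borel_measurable lborel" using h by simp
  define M where "M = density lborel (\<lambda>x. ennreal (h x))"
  have "emeasure M (space M) = 1"
    using one h pos by (simp add: M_def emeasure_density nn_integral_eq_integral)
  then interpret prob_space M by (rule prob_spaceI)
  interpret real_distribution M
    by unfold_locales (auto simp: M_def)
  have M: "measure M A = (LINT x:A|lborel. h x)" if "A \<in> sets borel" for A
  proof -
    have A: "integrable lborel (\<lambda>x. indicator A x *\<^sub>R h x)"
      using that h by (intro integrable_mult_indicator) auto
    have "emeasure M A = (\<integral>\<^sup>+x. ennreal (indicator A x *\<^sub>R h x) \<partial>lborel)"
      using that by (auto simp: M_def emeasure_density split: split_indicator intro!: nn_integral_cong)
    also have "\<dots> = ennreal (LINT x:A|lborel. h x)"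
      unfolding set_lebesgue_integral_def using A pos by (intro nn_integral_eq_integral) auto
    finally show ?thesis
      unfolding measure_def set_lebesgue_integral_def using pos by simp
  qed
  \<comment> \<open>Levy's theorem asks that the endpoints of the interval carry no mass.\<close>
  have null: "measure M {c} = 0" for c
  proof -
    have "(LINT x:{c}|lborel. h x) = (LINT x::real|lborel. 0)"
      unfolding set_lebesgue_integral_def
    proof (rule Bochner_Integration.integral_cong_AE)
      show "AE x in lborel. indicat_real {c} x *\<^sub>R h x = 0"
        using AE_lborel_singleton[of c] by eventually_elim simp
    qed auto
    then show ?thesis by (simp add: M)
  qed
  have char: "char M t = fourier (\<lambda>x. of_real (h x)) (- t)" for t
    unfolding char_def fourier_def M_def cis_conv_exp
    by (subst integral_density) (use pos in \<open>auto simp: scaleR_conv_of_real mult_ac\<close>)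
  have "(\<lambda>n. 1 / (2 * pi) * (CLBINT t=-real n..real n.
            (iexp (-(t * a)) - iexp (-(t * b))) / (\<i> * t) * char M t)) \<longlonglongrightarrow> measure M {a<..b}"
    using Levy_Inversion[OF ab null null] by simp
  moreover have "1 / (2 * pi) * (CLBINT t=-real n..real n.
            (iexp (-(t * a)) - iexp (-(t * b))) / (\<i> * t) * char M t)
       = truncated_inversion a b (\<lambda>x. of_real (h x)) n" for n
  proof -
    have "(CLBINT t=-real n..real n. (iexp (-(t * a)) - iexp (-(t * b))) / (\<i> * t) * char M t)
        = (LINT t|lborel. indicator {- real n<..<real n} t *\<^sub>R
             ((iexp (-(t * a)) - iexp (-(t * b))) / (\<i> * t) * char M t))"
      by (simp add: interval_lebesgue_integral_def set_lebesgue_integral_def)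
    also have "\<dots> = (LINT t|lborel. indicator {- real n<..<real n} t *\<^sub>R
             (Ioc_kernel a b t * fourier (\<lambda>x. of_real (h x)) (- t)))"
    \<comment> \<open>At \<open>t = 0\<close> the quotient is 0 by the convention for division,
      whereas the kernel equals \<open>b - a\<close>; a single point is null.\<close>
    proof (rule Bochner_Integration.integral_cong_AE)
      show "(\<lambda>t. indicator {- real n<..<real n} t *\<^sub>R
             (Ioc_kernel a b t * fourier (\<lambda>x. of_real (h x)) (- t))) \<in> borel_measurable lborel"
        using integrable_kernel_fourier[of "\<lambda>x. of_real (h x)"] h by simp
      show "AE t in lborel. indicator {- real n<..<real n} t *\<^sub>R
             ((iexp (-(t * a)) - iexp (-(t * b))) / (\<i> * t) * char M t) =
           indicator {- real n<..<real n} t *\<^sub>R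
             (Ioc_kernel a b t * fourier (\<lambda>x. of_real (h x)) (- t))"
        using AE_lborel_singleton[of 0]
        by eventually_elim (simp add: Ioc_kernel_eq[OF ab] char cis_conv_exp)
    qed auto
    finally show ?thesis by (simp add: truncated_inversion_def)
  qed
  ultimately have "truncated_inversion a b (\<lambda>x. of_real (h x)) \<longlonglongrightarrow> measure M {a<..b}"
    by simp
  also have "complex_of_real (measure M {a<..b}) = (LINT x:{a<..b}|lborel. of_real (h x))"
    by (simp add: M set_lebesgue_integral_def scaleR_conv_of_real flip: integral_complex_of_real)
  finally show ?thesis .
qed

lemma set_integrable_of_integrable:
  fixes f :: "real \<Rightarrow> 'b::{banach,second_countable_topology}"
  assumes "integrable lborel f" "A \<in> sets borel"
  shows "set_integrable lborel A f"
  using integrable_mult_indicator[of A lborel f] assms by (simp add: set_integrable_def)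

lemma inversion_lincomb:
  assumes "integrable lborel f" "integrable lborel g"
    and "truncated_inversion a b f \<longlonglongrightarrow> (LINT x:{a<..b}|lborel. f x)"
    and "truncated_inversion a b g \<longlonglongrightarrow> (LINT x:{a<..b}|lborel. g x)"
  shows "truncated_inversion a b (\<lambda>x. c * f x + d * g x) \<longlonglongrightarrow> (LINT x:{a<..b}|lborel. c * f x + d * g x)"
proof -
  have "(LINT x:{a<..b}|lborel. c * f x + d * g x)
      = c * (LINT x:{a<..b}|lborel. f x) + d * (LINT x:{a<..b}|lborel. g x)"
    using set_integrable_of_integrable[OF assms(1), of "{a<..b}"] set_integrable_of_integrable[OF assms(2), of "{a<..b}"]
    by (subst set_integral_add) auto
  moreover have "truncated_inversion a b (\<lambda>x. c * f x + d * g x)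
      = (\<lambda>n. c * truncated_inversion a b f n + d * truncated_inversion a b g n)"
    by (intro ext truncated_inversion_lincomb assms)
  ultimately show ?thesis by (auto intro!: tendsto_intros assms)
qed

text \<open>Dividing by the total mass reduces to a probability density. If the mass is zero,
  \<open>h\<close> vanishes almost everywhere and so do both sides.\<close>

lemma inversion_nonneg:
  fixes h :: "real \<Rightarrow> real"
  assumes ab: "a \<le> b" and h: "integrable lborel h" and pos: "\<And>x. 0 \<le> h x"
  shows "truncated_inversion a b (\<lambda>x. of_real (h x)) \<longlonglongrightarrow> (LINT x:{a<..b}|lborel. of_real (h x))"
proof (cases "(LINT x|lborel. h x) = 0")
  case True
  then have *: "AE x in lborel. h x = 0"
    using h pos by (subst (asm) integral_nonneg_eq_0_iff_AE) auto
  have "fourier (\<lambda>x. of_real (h x)) t = 0" for t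
  proof -
    have "fourier (\<lambda>x. of_real (h x)) t = (LINT x::real|lborel. 0)"
      unfolding fourier_def
    proof (rule Bochner_Integration.integral_cong_AE)
      show "AE x in lborel. complex_of_real (h x) * cis (- (t * x)) = 0"
        using * by eventually_elim simp
    qed (use h integrable_mult_cis[of "\<lambda>x. of_real (h x)" t] in auto)
    then show ?thesis by simp
  qed
  moreover have "(LINT x:{a<..b}|lborel. complex_of_real (h x)) = (LINT x::real|lborel. 0)"
    unfolding set_lebesgue_integral_def
  proof (rule Bochner_Integration.integral_cong_AE)
    show "AE x in lborel. indicat_real {a<..b} x *\<^sub>R complex_of_real (h x) = 0"
      using * by eventually_elim simp
  qed (use h in auto)
  ultimately show ?thesis by (simp add: truncated_inversion_def[abs_def])
next
  case False
  define c where "c = (LINT x|lborel. h x)"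
  have "c \<ge> 0" unfolding c_def by (rule Bochner_Integration.integral_nonneg) (rule pos)
  with False have c: "c > 0" by (simp add: c_def)
  have "truncated_inversion a b (\<lambda>x. of_real (h x / c)) \<longlonglongrightarrow> (LINT x:{a<..b}|lborel. of_real (h x / c))"
  proof (rule inversion_density[OF ab])
    show "(LINT x|lborel. h x / c) = 1" using c by (simp add: c_def[symmetric])
  qed (use c h pos in auto)
  \<comment> \<open>The second summand with coefficient 0 casts rescaling as an instance of
    \<open>inversion_lincomb\<close>.\<close>
  then have "truncated_inversion a b (\<lambda>x. of_real c * of_real (h x / c) + 0 * of_real (h x / c))
     \<longlonglongrightarrow> (LINT x:{a<..b}|lborel. of_real c * of_real (h x / c) + 0 * of_real (h x / c))"
    using h by (intro inversion_lincomb) auto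
  moreover have "complex_of_real c * of_real (h x / c) + 0 * of_real (h x / c) = of_real (h x)" for x
    using c by simp
  ultimately show ?thesis by simp
qed

text \<open>Split \<open>f\<close> into real and imaginary parts, and each of these into positive
  and negative parts.\<close>

theorem fourier_inversion_Ioc:
  assumes ab: "a \<le> b" and f: "integrable lborel f"
  shows "truncated_inversion a b f \<longlonglongrightarrow> (LINT x:{a<..b}|lborel. f x)"
proof -
  have real: "truncated_inversion a b (\<lambda>x. of_real (h x)) \<longlonglongrightarrow> (LINT x:{a<..b}|lborel. of_real (h x))"
    if h: "integrable lborel h" for h :: "real \<Rightarrow> real"
  proof -
    have 1: "integrable lborel (\<lambda>x. max 0 (h x))" "integrable lborel (\<lambda>x. max 0 (- h x))"
      using h by auto
    have "truncated_inversion a b (\<lambda>x. 1 * of_real (max 0 (h x)) + (- 1) * of_real (max 0 (- h x)))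
       \<longlonglongrightarrow> (LINT x:{a<..b}|lborel. 1 * of_real (max 0 (h x)) + (- 1) * of_real (max 0 (- h x)))"
      using 1 by (intro inversion_lincomb inversion_nonneg ab) auto
    moreover have "1 * complex_of_real (max 0 (h x)) + (- 1) * complex_of_real (max 0 (- h x)) = of_real (h x)" for x
      by (auto simp: max_def simp flip: of_real_minus)
    ultimately show ?thesis by simp
  qed
  have "truncated_inversion a b (\<lambda>x. 1 * of_real (Re (f x)) + \<i> * of_real (Im (f x)))
       \<longlonglongrightarrow> (LINT x:{a<..b}|lborel. 1 * of_real (Re (f x)) + \<i> * of_real (Im (f x)))"
    using f by (intro inversion_lincomb real) auto
  moreover have "1 * of_real (Re (f x)) + \<i> * of_real (Im (f x)) = f x" for x
    by (simp add: complex_eq_iff)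
  ultimately show ?thesis by simp
qed

section \<open>Band-limited functions and their continuous representatives\<close>

lemma fourier_outside:
  assumes "f \<in> Bsig \<sigma>" "\<bar>t\<bar> > \<sigma>"
  shows "fourier f t = 0"
proof (rule ccontr)
  assume "fourier f t \<noteq> 0"
  then have "t \<in> closure {t. fourier f t \<noteq> 0}"
    by (intro subsetD[OF closure_subset]) simp
  with assms have "t \<in> {-\<sigma>..\<sigma>}" unfolding Bsig_def by blast
  with assms(2) show False by auto
qed

text \<open>
  \<open>band_weight \<sigma> f\<close> is arranged so that its Fourier transform is the inversion integral of \<open>f\<close>, and
  hence the continuous representative of \<open>f\<close>.
\<close>

definition band_weight :: "real \<Rightarrow> (real \<Rightarrow> complex) \<Rightarrow> real \<Rightarrow> complex" where
  "band_weight \<sigma> f t = indicator {-\<sigma>..\<sigma>} t * (fourier f (- t) / (2 * pi))"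

lemma integrable_band_weight:
  assumes "integrable lborel f"
  shows "integrable lborel (band_weight \<sigma> f)"
proof -
  have "continuous_on {-\<sigma>..\<sigma>} (\<lambda>t. fourier f (- t) / (2 * pi))"
    by (intro continuous_on_divide continuous_on_fourier_uminus assms continuous_on_const) simp
  then have "integrable lborel (\<lambda>t. indicator {-\<sigma>..\<sigma>} t *\<^sub>R (fourier f (- t) / (2 * pi)))"
    by (intro borel_integrable_compact) auto
  then show ?thesis
    by (rule Bochner_Integration.integrable_cong[THEN iffD1, rotated -1])
       (auto simp: band_weight_def split: split_indicator)
qed

text \<open>Once the truncation window contains the band, the truncated inversion integral no longer
  depends on \<open>n\<close> and equals the interval integral of
  \<open>fourier (band_weight \<sigma> f)\<close>. Its limit is the interval integral of
  \<open>f\<close>, so both functions have the same integrals over all half-open intervals.\<close>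

lemma fourier_band_weight_AE_eq:
  assumes f: "f \<in> Bsig \<sigma>"
  shows "AE x in lborel. fourier (band_weight \<sigma> f) x = f x"
proof -
  have fi: "integrable lborel f" using f by (simp add: Bsig_def)
  note w = integrable_band_weight[OF fi, of \<sigma>]
  have eq: "(LINT x:{a<..b}|lborel. fourier (band_weight \<sigma> f) x) = (LINT x:{a<..b}|lborel. f x)"
    if ab: "a \<le> b" for a b
  proof -
    \<comment> \<open>Strict inequality puts the closed band inside the open window.\<close>
    obtain N :: nat where N: "\<sigma> < real N" using reals_Archimedean2 by blast
    have "truncated_inversion a b f n = (LINT x:{a<..b}|lborel. fourier (band_weight \<sigma> f) x)"
      if n: "n \<ge> N" for n
    proof -
      have "truncated_inversion a b f n = (LINT t|lborel. 1 / (2 * pi) *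
             (indicator {- real n<..<real n} t *\<^sub>R (Ioc_kernel a b t * fourier f (- t))))"
        by (simp only: truncated_inversion_def integral_mult_right_zero)
      also have "\<dots> = (LINT t|lborel. band_weight \<sigma> f t * Ioc_kernel a b t)"
      proof (rule Bochner_Integration.integral_cong[OF refl])
        fix t :: real
        show "1 / (2 * pi) * (indicator {- real n<..<real n} t *\<^sub>R (Ioc_kernel a b t * fourier f (- t)))
            = band_weight \<sigma> f t * Ioc_kernel a b t"
        proof (cases "\<bar>t\<bar> \<le> \<sigma>")
          case True
          with N n have "t \<in> {- real n<..<real n}" "t \<in> {-\<sigma>..\<sigma>}" by auto
          then show ?thesis by (simp add: band_weight_def)
        next
          case False
          then have "fourier f (- t) = 0" by (intro fourier_outside[OF f]) simp
          then show ?thesis by (simp add: band_weight_def)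
        qed
      qed
      finally show ?thesis by (simp add: Ioc_integral_fourier[OF w])
    qed
    then have "\<forall>\<^sub>F n in sequentially. truncated_inversion a b f n
                 = (LINT x:{a<..b}|lborel. fourier (band_weight \<sigma> f) x)"
      by (auto simp: eventually_sequentially)
    then have "truncated_inversion a b f \<longlonglongrightarrow> (LINT x:{a<..b}|lborel. fourier (band_weight \<sigma> f) x)"
      by (rule tendsto_eventually)
    with fourier_inversion_Ioc[OF ab fi] show ?thesis by (rule LIMSEQ_unique[symmetric])
  qed
  have int: "set_integrable lborel {a<..b} (fourier (band_weight \<sigma> f))" for a b
  proof -
    have "set_integrable lborel {a..b} (fourier (band_weight \<sigma> f))"
      unfolding set_integrable_def
      by (intro borel_integrable_compact continuous_on_fourier w) auto
    then show ?thesis by (rule set_integrable_subset) auto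
  qed
  have fint: "set_integrable lborel {a<..b} f" for a b
    by (intro set_integrable_of_integrable fi) simp
  have "AE x in lborel. fourier (band_weight \<sigma> f) x - f x = 0"
    by (rule AE_eq_0_if_Ioc_integrals_eq_0)
       (use eq int fint in \<open>auto simp: set_integral_diff\<close>)
  then show ?thesis by simp
qed

section \<open>Compactness of the unit ball\<close>

text \<open>The transform is bounded by \<open>l1norm f\<close>, and the band of length
  \<open>2 * \<sigma>\<close> is weighted by \<open>1 / (2 * pi)\<close>.\<close>

lemma l1norm_band_weight_le:
  assumes "\<sigma> > 0" and f: "integrable lborel f"
  shows "l1norm (band_weight \<sigma> f) \<le> \<sigma> / pi * l1norm f"
proof -
  have *: "cmod (band_weight \<sigma> f t) \<le> indicator {-\<sigma>..\<sigma>} t * (l1norm f / (2 * pi))" for t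
    using norm_fourier_le[of f "- t"]
    by (auto simp: band_weight_def norm_mult norm_divide divide_right_mono split: split_indicator)
  have "l1norm (band_weight \<sigma> f) \<le> (LINT t|lborel. indicator {-\<sigma>..\<sigma>} t * (l1norm f / (2 * pi)))"
    unfolding l1norm_def[of "band_weight \<sigma> f"] using *
    by (intro integral_mono integrable_norm integrable_band_weight f integrable_mult_left integrable_real_indicator)
       (auto simp: emeasure_lborel_Icc_eq)
  also have "\<dots> = \<sigma> / pi * l1norm f"
    using assms by simp
  finally show ?thesis .
qed

lemma norm_cis_diff_le: "cmod (cis x - cis y) \<le> \<bar>x - y\<bar>"
proof -
  have *: "cmod (cis x - cis y) \<le> x - y" if "y \<le> x" for x y
    \<comment> \<open>The bound on Levy's kernel, taken at frequency 1, says that a chord of the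
      unit circle is at most as long as its arc.\<close>
    using Levy_Inversion_aux2[OF that, of 1] by (simp add: cis_conv_exp norm_divide norm_mult)
  show ?thesis
    using *[of x y] *[of y x] by (cases "x \<le> y") (auto simp: norm_minus_commute)
qed

text \<open>The weight lives on \<open>\<bar>t\<bar> \<le> \<sigma>\<close>, where every character
  \<open>cis (- (x * t))\<close> is Lipschitz in \<open>x\<close> with constant
  \<open>\<sigma>\<close>.\<close>

lemma fourier_band_weight_Lipschitz:
  assumes "\<sigma> > 0" and f: "integrable lborel f"
  shows "cmod (fourier (band_weight \<sigma> f) x - fourier (band_weight \<sigma> f) y)
           \<le> \<sigma> * l1norm (band_weight \<sigma> f) * \<bar>x - y\<bar>"
proof -
  let ?w = "band_weight \<sigma> f"
  note w = integrable_band_weight[OF f, of \<sigma>]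
  have i: "integrable lborel (\<lambda>t. ?w t * (cis (- (x * t)) - cis (- (y * t))))"
    using integrable_mult_cis[OF w] by (simp add: right_diff_distrib)
  have *: "cmod (?w t * (cis (- (x * t)) - cis (- (y * t)))) \<le> (\<sigma> * \<bar>x - y\<bar>) * cmod (?w t)" for t
  proof (cases "\<bar>t\<bar> \<le> \<sigma>")
    case True
    have "cmod (cis (- (x * t)) - cis (- (y * t))) \<le> \<bar>- (x * t) - - (y * t)\<bar>"
      by (rule norm_cis_diff_le)
    also have "\<dots> = \<bar>x - y\<bar> * \<bar>t\<bar>"
      by (simp add: abs_mult[symmetric] left_diff_distrib abs_minus_commute)
    also have "\<dots> \<le> \<bar>x - y\<bar> * \<sigma>"
      using True by (intro mult_left_mono) auto
    finally have "cmod (?w t) * cmod (cis (- (x * t)) - cis (- (y * t))) \<le> cmod (?w t) * (\<bar>x - y\<bar> * \<sigma>)"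
      by (rule mult_left_mono) simp
    then show ?thesis by (simp add: norm_mult mult_ac)
  next
    case False
    then have "t \<notin> {-\<sigma>..\<sigma>}" by auto
    then show ?thesis by (simp add: band_weight_def)
  qed
  have "fourier ?w x - fourier ?w y = (LINT t|lborel. ?w t * (cis (- (x * t)) - cis (- (y * t))))"
    unfolding fourier_def using integrable_mult_cis[OF w] by (simp add: right_diff_distrib)
  also have "cmod \<dots> \<le> (LINT t|lborel. cmod (?w t * (cis (- (x * t)) - cis (- (y * t)))))"
    by (rule integral_norm_bound)
  also have "\<dots> \<le> (LINT t|lborel. (\<sigma> * \<bar>x - y\<bar>) * cmod (?w t))"
    using * i w by (intro integral_mono) auto
  also have "\<dots> = \<sigma> * l1norm ?w * \<bar>x - y\<bar>"
    by (simp add: l1norm_def)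
  finally show ?thesis .
qed

text \<open>The Arzela-Ascoli argument: a diagonal subsequence converges at all rationals, and the
  common Lipschitz constant carries the Cauchy property to every real.\<close>

lemma Lipschitz_convergent_subsequence:
  fixes F :: "nat \<Rightarrow> real \<Rightarrow> complex"
  assumes bound: "\<And>n x. cmod (F n x) \<le> B"
    and lip: "\<And>n x y. cmod (F n x - F n y) \<le> L * \<bar>x - y\<bar>"
  obtains r g where "strict_mono (r :: nat \<Rightarrow> nat)" "\<forall>x. (\<lambda>n. F (r n) x) \<longlonglongrightarrow> g x"
proof -
  obtain r where r: "strict_mono (r :: nat \<Rightarrow> nat)" "\<And>q. q \<in> \<rat> \<Longrightarrow> \<exists>l. (\<lambda>n. F (r n) q) \<longlonglongrightarrow> l"
    using function_convergent_subsequence[OF countable_rat, of F B] bound by metis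
  have "Cauchy (\<lambda>n. F (r n) x)" for x
  proof (rule CauchyI)
    fix e :: real assume "e > 0"
    \<comment> \<open>The divisor \<open>\<bar>L\<bar> + 1\<close> is positive whatever the sign of
      \<open>L\<close>.\<close>
    define d where "d = e / 3 / (\<bar>L\<bar> + 1)"
    have d: "d > 0" using \<open>e > 0\<close> by (simp add: d_def)
    obtain q where q: "q \<in> \<rat>" "x < q" "q < x + d" using Rats_dense_in_real[of x "x + d"] d by auto
    have xq: "cmod (F n x - F n q) < e / 3" for n
    proof -
      have "cmod (F n x - F n q) \<le> L * \<bar>x - q\<bar>" by (rule lip)
      also have "\<dots> \<le> (\<bar>L\<bar> + 1) * \<bar>x - q\<bar>" by (intro mult_right_mono) auto
      also have "\<dots> < (\<bar>L\<bar> + 1) * d" using q by (intro mult_strict_left_mono) auto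
      also have "\<dots> = e / 3"
      proof -
        have "\<bar>L\<bar> + 1 \<noteq> 0" by linarith
        then show ?thesis unfolding d_def by (simp add: field_simps)
      qed
      finally show ?thesis .
    qed
    from r(2)[OF q(1)] have "Cauchy (\<lambda>n. F (r n) q)" using LIMSEQ_imp_Cauchy by blast
    then obtain M where M: "\<And>m n. m \<ge> M \<Longrightarrow> n \<ge> M \<Longrightarrow> cmod (F (r m) q - F (r n) q) < e / 3"
      using \<open>e > 0\<close> CauchyD[of "\<lambda>n. F (r n) q" "e / 3"] by auto
    show "\<exists>M. \<forall>m\<ge>M. \<forall>n\<ge>M. cmod (F (r m) x - F (r n) x) < e"
    proof (intro exI allI impI)
      fix m n assume "m \<ge> M" "n \<ge> M"
      have "F (r m) x - F (r n) x
          = (F (r m) x - F (r m) q) + (F (r m) q - F (r n) q) - (F (r n) x - F (r n) q)" by simp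
      also have "cmod \<dots> \<le> cmod (F (r m) x - F (r m) q) + cmod (F (r m) q - F (r n) q) + cmod (F (r n) x - F (r n) q)"
        by (intro order_trans[OF norm_triangle_ineq4] add_right_mono norm_triangle_ineq)
      also have "\<dots> < e" using xq[of "r m"] xq[of "r n"] M[OF \<open>m \<ge> M\<close> \<open>n \<ge> M\<close>] by simp
      finally show "cmod (F (r m) x - F (r n) x) < e" .
    qed
  qed
  then have "\<forall>x. \<exists>l. (\<lambda>n. F (r n) x) \<longlonglongrightarrow> l"
    using convergent_eq_Cauchy by blast
  then obtain g where "\<forall>x. (\<lambda>n. F (r n) x) \<longlonglongrightarrow> g x" by metis
  with r(1) that show thesis by blast
qed

text \<open>Fatou's lemma, applied in \<open>ennreal\<close>, bounds the norm of the limit and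
  thereby also proves its integrability.\<close>

lemma integrable_l1norm_le_pointwise_limit:
  fixes F :: "nat \<Rightarrow> real \<Rightarrow> complex"
  assumes F: "\<And>n. integrable lborel (F n)" and bound: "\<And>n. l1norm (F n) \<le> C"
    and lim: "\<And>x. (\<lambda>n. F n x) \<longlonglongrightarrow> g x"
  shows "integrable lborel g" "l1norm g \<le> C"
proof -
  have [measurable]: "F n \<in> borel_measurable lborel" for n using F by simp
  have g [measurable]: "g \<in> borel_measurable lborel"
    by (rule borel_measurable_LIMSEQ_metric[OF _ lim]) simp
  have "0 \<le> l1norm (F 0)" by (simp add: l1norm_def)
  with bound[of 0] have C: "C \<ge> 0" by simp
  have "(\<integral>\<^sup>+x. ennreal (cmod (g x)) \<partial>lborel) = (\<integral>\<^sup>+x. liminf (\<lambda>n. ennreal (cmod (F n x))) \<partial>lborel)"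
    by (intro nn_integral_cong lim_imp_Liminf[symmetric] tendsto_ennrealI tendsto_norm lim) simp
  also have "\<dots> \<le> liminf (\<lambda>n. \<integral>\<^sup>+x. ennreal (cmod (F n x)) \<partial>lborel)"
    by (rule nn_integral_liminf) simp
  also have "\<dots> \<le> ennreal C"
  proof (rule Liminf_le, simp, rule always_eventually, rule allI)
    fix n
    have "(\<integral>\<^sup>+x. ennreal (cmod (F n x)) \<partial>lborel) = ennreal (l1norm (F n))"
      unfolding l1norm_def using F by (intro nn_integral_eq_integral) auto
    then show "(\<integral>\<^sup>+x. ennreal (cmod (F n x)) \<partial>lborel) \<le> ennreal C"
      using bound[of n] by (simp add: ennreal_leI)
  qed
  finally have le: "(\<integral>\<^sup>+x. ennreal (cmod (g x)) \<partial>lborel) \<le> ennreal C" .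
  then show gi: "integrable lborel g"
    by (intro integrableI_bounded g) (auto intro: le_less_trans)
  have "(\<integral>\<^sup>+x. ennreal (cmod (g x)) \<partial>lborel) = ennreal (l1norm g)"
    unfolding l1norm_def using gi by (intro nn_integral_eq_integral) auto
  with le C show "l1norm g \<le> C" by (simp add: ennreal_le_iff)
qed

section \<open>Pairing with functions vanishing at infinity\<close>

lemma C0_bounded:
  assumes "u \<in> C0"
  obtains K where "\<And>x. cmod (u x) \<le> K"
proof -
  from assms have c: "continuous_on UNIV u" and l: "(u \<longlongrightarrow> 0) at_infinity" by (auto simp: C0_def)
  from tendstoD[OF l, of 1] obtain R where R: "\<And>x. R \<le> norm x \<Longrightarrow> cmod (u x) < 1"
    by (auto simp: eventually_at_infinity)
  have "bounded (u ` {-\<bar>R\<bar>..\<bar>R\<bar>})"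
    by (intro compact_imp_bounded compact_continuous_image continuous_on_subset[OF c]) auto
  then obtain K where K: "\<And>x. x \<in> {-\<bar>R\<bar>..\<bar>R\<bar>} \<Longrightarrow> cmod (u x) \<le> K" unfolding bounded_iff by blast
  have "cmod (u x) \<le> max K 1" for x
    using R[of x] K[of x] by (cases "x \<in> {-\<bar>R\<bar>..\<bar>R\<bar>}") force+
  then show thesis by (rule that)
qed

lemma C0_measurable: "u \<in> C0 \<Longrightarrow> u \<in> borel_measurable lborel"
  by (simp add: C0_def borel_measurable_continuous_onI)

lemma integrable_mult_C0:
  assumes f: "integrable lborel f" and u: "u \<in> C0"
  shows "integrable lborel (\<lambda>x. f x * u x)"
proof -
  obtain K where K: "\<And>x. cmod (u x) \<le> K" using C0_bounded[OF u] by blast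
  have [measurable]: "f \<in> borel_measurable lborel" "u \<in> borel_measurable lborel"
    using f C0_measurable[OF u] by auto
  have "integrable lborel (\<lambda>x. of_real K * f x)" using f by simp
  then show ?thesis
  proof (rule Bochner_Integration.integrable_bound)
    have "cmod (f x) * cmod (u x) \<le> cmod (f x) * \<bar>K\<bar>" for x
      using K[of x] by (intro mult_left_mono) auto
    then show "AE x in lborel. cmod (f x * u x) \<le> cmod (of_real K * f x)"
      by (simp add: norm_mult mult.commute)
  qed simp
qed

lemma l1norm_diff_le:
  assumes "integrable lborel f" "integrable lborel g"
  shows "l1norm (\<lambda>x. f x - g x) \<le> l1norm f + l1norm g"
proof -
  have "l1norm (\<lambda>x. f x - g x) \<le> (LINT x|lborel. cmod (f x) + cmod (g x))"
    unfolding l1norm_def using assms by (intro integral_mono norm_triangle_ineq4) auto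
  also have "\<dots> = l1norm f + l1norm g"
    unfolding l1norm_def using assms by simp
  finally show ?thesis .
qed

text \<open>On a bounded window the uniform bound \<open>B\<close> permits dominated convergence.
  Off the window \<open>u\<close> is below \<open>e / 4\<close>, while the difference has norm at
  most 2.\<close>

lemma weak_convergence_C0:
  assumes F: "\<And>n. integrable lborel (F n)" "\<And>n. l1norm (F n) \<le> 1"
    and g: "integrable lborel g" "l1norm g \<le> 1"
    and bound: "\<And>n x. cmod (F n x) \<le> B"
    and lim: "\<And>x. (\<lambda>n. F n x) \<longlonglongrightarrow> g x"
    and u: "u \<in> C0"
  shows "(\<lambda>n. LINT x|lborel. F n x * u x) \<longlonglongrightarrow> (LINT x|lborel. g x * u x)"
proof (rule LIMSEQ_I)
  fix e :: real assume e: "e > 0"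
  have [measurable]: "g \<in> borel_measurable lborel" "F n \<in> borel_measurable lborel"
    "u \<in> borel_measurable lborel" for n
    using F g C0_measurable[OF u] by auto
  obtain K where K: "\<And>x. cmod (u x) \<le> K" using C0_bounded[OF u] by blast
  have "(u \<longlongrightarrow> 0) at_infinity" using u by (simp add: C0_def)
  from tendstoD[OF this, of "e / 4"] e obtain R where R: "\<And>x. R \<le> norm x \<Longrightarrow> cmod (u x) < e / 4"
    by (auto simp: eventually_at_infinity)
  have gB: "cmod (g x) \<le> B" for x
    by (rule LIMSEQ_le_const2[OF tendsto_norm[OF lim]]) (use bound in auto)
  \<comment> \<open>The contribution of the window, dominated by the constant
    \<open>2 * B * K\<close> there.\<close>
  define h where "h n x = indicator {-R..R} x * (cmod (F n x - g x) * cmod (u x))" for n x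
  have dB: "cmod (F n x - g x) \<le> 2 * B" for n x
    using norm_triangle_ineq4[of "F n x" "g x"] bound[of n x] gB[of x] by simp
  have hB: "norm (h n x) \<le> indicator {-R..R} x * (2 * B * K)" for n x
    using dB[of n x] K[of x] by (auto simp: h_def abs_mult split: split_indicator intro!: mult_mono order_trans[OF norm_ge_zero dB])
  have iB: "integrable lborel (\<lambda>x. indicator {-R..R} x * (2 * B * K))"
    by (cases "-R \<le> R") (auto simp: integrable_indicator_iff)
  have hm [measurable]: "h n \<in> borel_measurable lborel" for n
    unfolding h_def by measurable
  have hi: "integrable lborel (h n)" for n
    by (rule Bochner_Integration.integrable_bound[OF iB hm])
       (auto intro!: AE_I2 order_trans[OF hB[unfolded real_norm_def]])
  have "(\<lambda>n. LINT x|lborel. h n x) \<longlonglongrightarrow> (LINT x::real|lborel. 0)"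
  proof (rule integral_dominated_convergence[OF _ hm iB])
    show "AE x in lborel. (\<lambda>n. h n x) \<longlonglongrightarrow> 0"
    proof (rule AE_I2)
      fix x
      have "(\<lambda>n. h n x) \<longlonglongrightarrow> indicator {-R..R} x * (cmod (g x - g x) * cmod (u x))"
        unfolding h_def by (intro tendsto_intros lim)
      then show "(\<lambda>n. h n x) \<longlonglongrightarrow> 0" by simp
    qed
  qed (use hB in auto)
  then have "(\<lambda>n. LINT x|lborel. h n x) \<longlonglongrightarrow> 0" by simp
  from LIMSEQ_D[OF this, of "e / 2"] e obtain N
    where N: "\<And>n. n \<ge> N \<Longrightarrow> (LINT x|lborel. h n x) < e / 2" by fastforce
  show "\<exists>N. \<forall>n\<ge>N. norm ((LINT x|lborel. F n x * u x) - (LINT x|lborel. g x * u x)) < e"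
  proof (intro exI allI impI)
    fix n assume n: "n \<ge> N"
    have d: "integrable lborel (\<lambda>x. F n x - g x)" using F g by auto
    have "(LINT x|lborel. F n x * u x) - (LINT x|lborel. g x * u x)
        = (LINT x|lborel. (F n x - g x) * u x)"
      using integrable_mult_C0[OF F(1) u] integrable_mult_C0[OF g(1) u] by (simp add: left_diff_distrib)
    also have "cmod \<dots> \<le> (LINT x|lborel. cmod ((F n x - g x) * u x))"
      by (rule integral_norm_bound)
    also have "\<dots> \<le> (LINT x|lborel. h n x + e / 4 * cmod (F n x - g x))"
    proof (rule integral_mono)
      show "integrable lborel (\<lambda>x. cmod ((F n x - g x) * u x))"
        by (intro integrable_norm integrable_mult_C0 d u)
      show "integrable lborel (\<lambda>x. h n x + e / 4 * cmod (F n x - g x))"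
        using hi d by auto
      fix x
      show "cmod ((F n x - g x) * u x) \<le> h n x + e / 4 * cmod (F n x - g x)"
      proof (cases "x \<in> {-R..R}")
        case True
        then show ?thesis using e by (simp add: h_def norm_mult)
      next
        case False
        then have "cmod (u x) \<le> e / 4" using R[of x] by force
        then have "cmod (u x) * cmod (F n x - g x) \<le> e / 4 * cmod (F n x - g x)"
          by (rule mult_right_mono) simp
        with False show ?thesis by (simp add: h_def norm_mult mult.commute)
      qed
    qed
    also have "\<dots> = (LINT x|lborel. h n x) + e / 4 * l1norm (\<lambda>x. F n x - g x)"
      unfolding l1norm_def using hi d by simp
    also have "\<dots> \<le> (LINT x|lborel. h n x) + e / 4 * 2"
    proof (intro add_left_mono mult_left_mono)
      show "l1norm (\<lambda>x. F n x - g x) \<le> 2"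
        using l1norm_diff_le[OF F(1) g(1), of n] F(2)[of n] g(2) by simp
    qed (use e in simp)
    also have "\<dots> < e" using N[OF n] by simp
    finally show "norm ((LINT x|lborel. F n x * u x) - (LINT x|lborel. g x * u x)) < e" .
  qed
qed

section \<open>Closedness of the band-limited space under weak limits\<close>

lemma Bsig_I:
  assumes "integrable lborel g" "\<And>t. \<bar>t\<bar> > \<sigma> \<Longrightarrow> fourier g t = 0"
  shows "g \<in> Bsig \<sigma>"
proof -
  have "{t. fourier g t \<noteq> 0} \<subseteq> {-\<sigma>..\<sigma>}"
  proof
    fix t assume "t \<in> {t. fourier g t \<noteq> 0}"
    then have "\<not> \<bar>t\<bar> > \<sigma>" using assms(2)[of t] by auto
    then show "t \<in> {-\<sigma>..\<sigma>}" by auto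
  qed
  then show ?thesis using assms(1) by (simp add: Bsig_def closure_minimal)
qed

text \<open>Characters do not vanish at infinity, so weak convergence says nothing directly about
  values of the transform. Its averages over intervals are pairings with \<open>Ioc_kernel\<close>
  and pass to the limit; continuity then recovers the values.\<close>

lemma Bsig_closed_weak:
  assumes F: "\<And>n. F n \<in> Bsig \<sigma>" and g: "integrable lborel g"
    and lim: "\<And>u. u \<in> C0 \<Longrightarrow> (\<lambda>n. LINT x|lborel. F n x * u x) \<longlonglongrightarrow> (LINT x|lborel. g x * u x)"
  shows "g \<in> Bsig \<sigma>"
proof (rule Bsig_I[OF g])
  fix t assume t: "\<bar>t\<bar> > \<sigma>"
  show "fourier g t = 0"
  proof (rule continuous_eq_0_if_Ioc_integrals_eq_0)
    show "continuous_on UNIV (fourier g)" by (rule continuous_on_fourier[OF g])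
    \<comment> \<open>This radius is the distance from \<open>t\<close> to the band, so every
      interval considered lies outside it.\<close>
    show "\<bar>t\<bar> - \<sigma> > 0" using t by simp
    fix a b assume ab: "t - (\<bar>t\<bar> - \<sigma>) < a" "a \<le> b" "b < t + (\<bar>t\<bar> - \<sigma>)"
    have "(LINT x|lborel. F n x * Ioc_kernel a b x) = 0" for n
    proof -
      have "fourier (F n) s = 0" if "s \<in> {a<..b}" for s
        by (rule fourier_outside[OF F]) (use that ab in auto)
      then have "(LINT s:{a<..b}|lborel. fourier (F n) s) = (LINT s:{a<..b}|lborel. 0)"
        by (intro set_lebesgue_integral_cong) auto
      then show ?thesis
        using Ioc_integral_fourier[of "F n" a b] F[of n] by (simp add: Bsig_def set_lebesgue_integral_def)
    qed
    with lim[OF Ioc_kernel_C0[OF ab(2)]] have "(LINT x|lborel. g x * Ioc_kernel a b x) = 0"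
      by (simp add: LIMSEQ_const_iff)
    then show "(LINT x:{a<..b}|lborel. fourier g x) = 0"
      by (simp add: Ioc_integral_fourier[OF g])
  qed
qed

lemma Bsig_cong_AE:
  assumes f: "f \<in> Bsig \<sigma>" and m: "F \<in> borel_measurable lborel" and ae: "AE x in lborel. F x = f x"
  shows "F \<in> Bsig \<sigma>" "l1norm F = l1norm f"
proof -
  have fi: "integrable lborel f" using f by (simp add: Bsig_def)
  have Fi: "integrable lborel F"
    using integrable_cong_AE[OF m borel_measurable_integrable[OF fi] ae] fi by simp
  have "fourier F t = fourier f t" for t
    unfolding fourier_def
  proof (rule integral_cong_AE)
    show "AE x in lborel. F x * cis (- (t * x)) = f x * cis (- (t * x))"
      using ae by eventually_elim simp
  qed (use integrable_mult_cis[OF fi] integrable_mult_cis[OF Fi] in auto)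
  then show "F \<in> Bsig \<sigma>" using f Fi by (simp add: Bsig_def)
  show "l1norm F = l1norm f"
    unfolding l1norm_def
  proof (rule integral_cong_AE)
    show "AE x in lborel. cmod (F x) = cmod (f x)"
      using ae by eventually_elim simp
  qed (use fi Fi in auto)
qed

text \<open>Sequential weak* compactness of the unit ball, strengthened by convergence almost
  everywhere. It is proved for the continuous representatives and transferred back off a null
  set.\<close>

lemma Dsig_subsequence:
  assumes \<sigma>: "\<sigma> > 0" and fs: "\<And>n. fs n \<in> Dsig \<sigma>"
  obtains r g where "strict_mono (r :: nat \<Rightarrow> nat)" "g \<in> Dsig \<sigma>"
    "AE x in lborel. (\<lambda>n. fs (r n) x) \<longlonglongrightarrow> g x"
    "\<And>u. u \<in> C0 \<Longrightarrow> (\<lambda>n. LINT x|lborel. fs (r n) x * u x) \<longlonglongrightarrow> (LINT x|lborel. g x * u x)"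
proof -
  have fB: "fs n \<in> Bsig \<sigma>" and fi: "integrable lborel (fs n)" and f1: "l1norm (fs n) \<le> 1" for n
    using fs[of n] by (auto simp: Dsig_def Bsig_def)
  define F where "F n = fourier (band_weight \<sigma> (fs n))" for n
  note w = integrable_band_weight[OF fi, of \<sigma>]
  have ae: "AE x in lborel. F n x = fs n x" for n
    unfolding F_def by (rule fourier_band_weight_AE_eq[OF fB])
  have Fm: "F n \<in> borel_measurable lborel" for n
    unfolding F_def using continuous_on_fourier[OF w, of UNIV] by (simp add: borel_measurable_continuous_onI)
  have FB: "F n \<in> Bsig \<sigma>" and F1: "l1norm (F n) \<le> 1" for n
    using Bsig_cong_AE[OF fB Fm ae, of n] f1[of n] by auto
  have Fi: "integrable lborel (F n)" for n using FB by (simp add: Bsig_def)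
  have w1: "l1norm (band_weight \<sigma> (fs n)) \<le> \<sigma> / pi" for n
  proof -
    have "\<sigma> / pi * l1norm (fs n) \<le> \<sigma> / pi * 1"
      using \<sigma> f1[of n] by (intro mult_left_mono) auto
    with l1norm_band_weight_le[OF \<sigma> fi, of n] show ?thesis by simp
  qed
  have bound: "cmod (F n x) \<le> \<sigma> / pi" for n x
    unfolding F_def by (rule order_trans[OF norm_fourier_le w1])
  have lip: "cmod (F n x - F n y) \<le> \<sigma> * (\<sigma> / pi) * \<bar>x - y\<bar>" for n x y
  proof -
    have "cmod (F n x - F n y) \<le> \<sigma> * l1norm (band_weight \<sigma> (fs n)) * \<bar>x - y\<bar>"
      unfolding F_def by (rule fourier_band_weight_Lipschitz[OF \<sigma> fi])
    also have "\<dots> \<le> \<sigma> * (\<sigma> / pi) * \<bar>x - y\<bar>"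
      by (rule mult_right_mono[OF mult_left_mono[OF w1]]) (use \<sigma> in auto)
    finally show ?thesis .
  qed
  obtain r g where r: "strict_mono (r :: nat \<Rightarrow> nat)" and "\<forall>x. (\<lambda>n. F (r n) x) \<longlonglongrightarrow> g x"
    using Lipschitz_convergent_subsequence[of F, OF bound lip] .
  then have lim: "(\<lambda>n. F (r n) x) \<longlonglongrightarrow> g x" for x by simp
  note g = integrable_l1norm_le_pointwise_limit[of "\<lambda>n. F (r n)" 1 g, OF Fi F1 lim]
  have weak: "(\<lambda>n. LINT x|lborel. F (r n) x * u x) \<longlonglongrightarrow> (LINT x|lborel. g x * u x)" if "u \<in> C0" for u
    by (rule weak_convergence_C0[OF Fi F1 g bound lim that])
  have "g \<in> Bsig \<sigma>" by (rule Bsig_closed_weak[of "\<lambda>n. F (r n)", OF FB g(1) weak])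
  then have gD: "g \<in> Dsig \<sigma>" using g(2) by (simp add: Dsig_def)
  have eq: "(LINT x|lborel. F n x * u x) = (LINT x|lborel. fs n x * u x)" if u: "u \<in> C0" for n u
  proof (rule integral_cong_AE)
    show "AE x in lborel. F n x * u x = fs n x * u x"
      using ae[of n] by eventually_elim simp
  qed (use integrable_mult_C0[OF fi u] integrable_mult_C0[OF Fi u] in auto)
  \<comment> \<open>Countably many exceptional null sets are merged into one.\<close>
  have "AE x in lborel. \<forall>n. F n x = fs n x" using ae by (simp add: AE_all_countable)
  then have "AE x in lborel. (\<lambda>n. fs (r n) x) \<longlonglongrightarrow> g x"
  proof eventually_elim
    case (elim x)
    with lim[of x] show ?case by simp
  qed
  with that[OF r gD] weak eq show thesis by simp
qed

section \<open>Weak* exposing functionals\<close>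

text \<open>Convergence of each pairing handles the subbasic sets, and induction over the generation
  of open sets gives convergence in the topology, which continuous maps preserve.\<close>

lemma weakstar_continuous_LIMSEQ:
  assumes fs: "\<And>n. fs n \<in> Bsig \<sigma>" and g: "g \<in> Bsig \<sigma>"
    and lim: "\<And>u. u \<in> C0 \<Longrightarrow> (\<lambda>n. LINT x|lborel. fs n x * u x) \<longlonglongrightarrow> (LINT x|lborel. g x * u x)"
    and \<Phi>: "weakstar_continuous \<sigma> \<Phi>"
  shows "(\<lambda>n. \<Phi> (fs n)) \<longlonglongrightarrow> \<Phi> g"
proof -
  let ?S = "{{g \<in> Bsig \<sigma>. (LINT x|lborel. g x * u x) \<in> U} | u U. u \<in> C0 \<and> open U}"
  have ev: "g \<in> U \<longrightarrow> (\<forall>\<^sub>F n in sequentially. fs n \<in> U)" if "generate_topology_on ?S U" for U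
    using that
  proof induction
    case Empty
    show ?case by simp
  next
    case (Int a b)
    then show ?case by (auto intro: eventually_conj)
  next
    case (UN K)
    show ?case
    proof
      assume "g \<in> \<Union>K"
      then obtain k where k: "k \<in> K" "g \<in> k" by auto
      with UN have "\<forall>\<^sub>F n in sequentially. fs n \<in> k" by auto
      then show "\<forall>\<^sub>F n in sequentially. fs n \<in> \<Union>K"
        by (rule eventually_mono) (use k in auto)
    qed
  next
    case (Basis s)
    then obtain u V where s: "s = {g \<in> Bsig \<sigma>. (LINT x|lborel. g x * u x) \<in> V}" and u: "u \<in> C0" "open V"
      by auto
    show ?case
    proof
      assume "g \<in> s"
      then have "(LINT x|lborel. g x * u x) \<in> V" by (simp add: s)
      from topological_tendstoD[OF lim[OF u(1)] u(2) this]
      show "\<forall>\<^sub>F n in sequentially. fs n \<in> s"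
        by (rule eventually_mono) (simp add: s fs)
    qed
  qed
  \<comment> \<open>The zero test function shows that \<open>Bsig \<sigma>\<close> itself is
    subbasic, so \<open>g\<close> belongs to the underlying space, as \<open>limitin\<close>
    demands.\<close>
  have "(\<lambda>x. 0) \<in> C0" by (simp add: C0_def)
  then have "Bsig \<sigma> \<in> ?S" by (intro CollectI exI[of _ "\<lambda>x. 0"] exI[of _ UNIV]) auto
  then have "g \<in> \<Union>?S" using g by blast
  then have "limitin (topology_generated_by ?S) fs g sequentially"
    unfolding limitin_def topology_generated_by_topspace openin_topology_generated_by_iff
    using ev by blast
  then have "limitin (weakstar_top \<sigma>) fs g sequentially"
    unfolding weakstar_top_def limitin_subtopology using g fs by simp
  from continuous_map_limit[OF \<Phi>[unfolded weakstar_continuous_def] this]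
  show ?thesis by (simp add: comp_def)
qed

text \<open>If the norm were below 1, the normalised \<open>f\<close> would stay in the ball while
  \<open>\<Phi>\<close> takes the value \<open>1 / l1norm f > 1\<close> on it, contradicting
  \<open>fnorm \<sigma> \<Phi> = 1\<close>.\<close>

lemma exposes_l1norm:
  assumes "exposes \<sigma> \<Phi> f"
  shows "l1norm f = 1"
proof -
  from assms have fB: "f \<in> Bsig \<sigma>" and f1: "l1norm f \<le> 1" and \<Phi>: "cont_lin_functional \<sigma> \<Phi>"
    and \<Phi>f: "\<Phi> f = 1" and norm: "fnorm \<sigma> \<Phi> = 1"
    by (auto simp: exposes_def Dsig_def)
  have fi: "integrable lborel f" using fB by (simp add: Bsig_def)
  from \<Phi> obtain C where C: "\<And>h. h \<in> Bsig \<sigma> \<Longrightarrow> cmod (\<Phi> h) \<le> C * l1norm h"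
    and lin: "\<And>a b. \<Phi> (\<lambda>x. a * f x + b * f x) = a * \<Phi> f + b * \<Phi> f"
    using fB unfolding cont_lin_functional_def by blast
  have nonneg: "l1norm h \<ge> 0" for h by (simp add: l1norm_def)
  have "l1norm f \<noteq> 0" using C[OF fB] \<Phi>f by auto
  with nonneg[of f] have pos: "l1norm f > 0" by simp
  define a where "a = complex_of_real (1 / l1norm f)"
  \<comment> \<open>The zero summand matches the two-term form of linearity in
    \<open>cont_lin_functional\<close>.\<close>
  let ?h = "\<lambda>x. a * f x + 0 * f x"
  have hB: "?h \<in> Bsig \<sigma>"
    by (rule Bsig_I) (use fi fourier_lincomb[OF fi fi, of a 0] fourier_outside[OF fB] in auto)
  have "l1norm ?h = 1"
    using pos by (simp add: l1norm_def a_def norm_mult norm_divide)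
  then have hD: "?h \<in> Dsig \<sigma>" using hB by (simp add: Dsig_def)
  \<comment> \<open>A real supremum dominates its values only for a set bounded above.\<close>
  have "bdd_above ((\<lambda>g. cmod (\<Phi> g)) ` Dsig \<sigma>)"
  proof (rule bdd_aboveI2)
    fix h assume h: "h \<in> Dsig \<sigma>"
    then have "cmod (\<Phi> h) \<le> C * l1norm h" using C by (simp add: Dsig_def)
    also have "\<dots> \<le> \<bar>C\<bar> * 1"
      using h nonneg[of h] by (intro mult_mono) (auto simp: Dsig_def)
    finally show "cmod (\<Phi> h) \<le> \<bar>C\<bar>" by simp
  qed
  from cSUP_upper[OF hD this] norm have "cmod (\<Phi> ?h) \<le> 1" by (simp add: fnorm_def)
  moreover have "\<Phi> ?h = a" using lin[of a 0] \<Phi>f by simp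
  ultimately have "1 / l1norm f \<le> 1" using pos by (simp add: a_def norm_divide)
  with pos f1 show ?thesis by (simp add: field_simps)
qed

section \<open>From subsequences to norm convergence\<close>

lemma LIMSEQ_if_subseq_subseq:
  fixes X :: "nat \<Rightarrow> 'a::metric_space"
  assumes "\<And>r. strict_mono (r :: nat \<Rightarrow> nat) \<Longrightarrow> \<exists>s. strict_mono (s :: nat \<Rightarrow> nat) \<and> (\<lambda>n. X (r (s n))) \<longlonglongrightarrow> L"
  shows "X \<longlonglongrightarrow> L"
proof (rule ccontr)
  assume "\<not> X \<longlonglongrightarrow> L"
  then obtain e where e: "e > 0" "\<not> (\<forall>\<^sub>F n in sequentially. dist (X n) L < e)"
    unfolding tendsto_iff by blast
  \<comment> \<open>Failure of convergence yields a subsequence staying at distance at least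
    \<open>e\<close> from \<open>L\<close>; no further subsequence of it can converge to
    \<open>L\<close>.\<close>
  have "infinite {n. \<not> dist (X n) L < e}"
    using e(2) by (simp add: cofinite_eq_sequentially[symmetric] eventually_cofinite)
  then obtain r :: "nat \<Rightarrow> nat" where r: "strict_mono r" "\<And>n. r n \<in> {n. \<not> dist (X n) L < e}"
    using infinite_enumerate by blast
  from assms[OF r(1)] obtain s where s: "(\<lambda>n. X (r (s n))) \<longlonglongrightarrow> L" by blast
  from tendstoD[OF this e(1)] r(2) show False by simp
qed

text \<open>The form of Scheffe's lemma in which an upper bound on the norms replaces their
  convergence.\<close>

lemma l1norm_LIMSEQ_if_AE:
  assumes F: "\<And>n. integrable lborel (F n)" and f: "integrable lborel f"
    and lim: "AE x in lborel. (\<lambda>n. F n x) \<longlonglongrightarrow> f x"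
    and le: "\<And>n. l1norm (F n) \<le> l1norm f"
  shows "(\<lambda>n. l1norm (\<lambda>x. F n x - f x)) \<longlonglongrightarrow> 0"
proof -
  have nn: "(\<integral>\<^sup>+x. ennreal (cmod (h x)) \<partial>lborel) = ennreal (l1norm h)" if "integrable lborel h" for h
    unfolding l1norm_def using that by (intro nn_integral_eq_integral) auto
  have "(\<lambda>n. \<integral>\<^sup>+x. ennreal (cmod (F n x - f x)) \<partial>lborel) \<longlonglongrightarrow> 0"
    by (rule Scheffe_lemma2[OF _ f lim]) (use F f le in \<open>auto simp: nn ennreal_leI\<close>)
  then have "(\<lambda>n. ennreal (l1norm (\<lambda>x. F n x - f x))) \<longlonglongrightarrow> ennreal 0"
    using F f by (simp add: nn)
  then show ?thesis
    by (rule tendsto_ennrealD) (auto simp: l1norm_def)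
qed

text \<open>The functional that witnesses weak* exposure also witnesses strong exposure. The
  subsequence principle reduces the claim to extracting a norm-convergent subsequence.\<close>

lemma weakstar_exposing_functional_strong:
  assumes \<sigma>: "\<sigma> > 0" and ex: "exposes \<sigma> \<Phi> f" and \<Phi>: "weakstar_continuous \<sigma> \<Phi>"
    and fs: "\<And>n. fs n \<in> Dsig \<sigma>" and lim: "(\<lambda>n. \<Phi> (fs n)) \<longlonglongrightarrow> 1"
  shows "(\<lambda>n. l1norm (\<lambda>x. fs n x - f x)) \<longlonglongrightarrow> 0"
proof (rule LIMSEQ_if_subseq_subseq)
  fix r :: "nat \<Rightarrow> nat" assume r: "strict_mono r"
  obtain s g where s: "strict_mono (s :: nat \<Rightarrow> nat)" and g: "g \<in> Dsig \<sigma>"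
    and ae: "AE x in lborel. (\<lambda>n. fs (r (s n)) x) \<longlonglongrightarrow> g x"
    and weak: "\<And>u. u \<in> C0 \<Longrightarrow> (\<lambda>n. LINT x|lborel. fs (r (s n)) x * u x) \<longlonglongrightarrow> (LINT x|lborel. g x * u x)"
    using Dsig_subsequence[OF \<sigma>, of "\<lambda>n. fs (r n)"] fs by blast
  have B: "fs n \<in> Bsig \<sigma>" "integrable lborel (fs n)" "l1norm (fs n) \<le> 1" for n
    using fs[of n] by (auto simp: Dsig_def Bsig_def)
  have gB: "g \<in> Bsig \<sigma>" "integrable lborel g" using g by (auto simp: Dsig_def Bsig_def)
  have fi: "integrable lborel f" using ex by (simp add: exposes_def Dsig_def Bsig_def)
  have "(\<lambda>n. \<Phi> (fs (r (s n)))) \<longlonglongrightarrow> \<Phi> g"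
    by (rule weakstar_continuous_LIMSEQ[OF B(1) gB(1) weak \<Phi>])
  moreover have "(\<lambda>n. \<Phi> (fs (r (s n)))) \<longlonglongrightarrow> 1"
    using LIMSEQ_subseq_LIMSEQ[OF lim strict_mono_o[OF r s]] by (simp add: comp_def)
  ultimately have "\<Phi> g = 1" by (rule LIMSEQ_unique)
  \<comment> \<open>Otherwise exposure would give \<open>Re (\<Phi> g) < 1\<close>.\<close>
  then have "l1norm (\<lambda>x. g x - f x) = 0" using ex g unfolding exposes_def by force
  then have "AE x in lborel. cmod (g x - f x) = 0"
    unfolding l1norm_def using gB fi by (subst (asm) integral_nonneg_eq_0_iff_AE) auto
  with ae have "AE x in lborel. (\<lambda>n. fs (r (s n)) x) \<longlonglongrightarrow> f x"
    by eventually_elim simp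
  \<comment> \<open>All norms are at most 1, which is exactly \<open>l1norm f\<close>, so no mass
    escapes in the limit.\<close>
  from l1norm_LIMSEQ_if_AE[OF B(2) fi this] B(3) exposes_l1norm[OF ex]
  have "(\<lambda>n. l1norm (\<lambda>x. fs (r (s n)) x - f x)) \<longlonglongrightarrow> 0" by simp
  with s show "\<exists>s. strict_mono (s :: nat \<Rightarrow> nat) \<and> (\<lambda>n. l1norm (\<lambda>x. fs (r (s n)) x - f x)) \<longlonglongrightarrow> 0"
    by blast
qed

theorem theorem4p4:
  fixes \<sigma> :: real
  assumes "0 < \<sigma>"
  shows "{f. weakstar_exposed_point \<sigma> f} = {f. weakstar_strongly_exposed_point \<sigma> f}"
  unfolding weakstar_strongly_exposed_point_def weakstar_exposed_point_def strongly_exposed_point_def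
  using weakstar_exposing_functional_strong[OF assms] by blast

end
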